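(* Let $\mathbb{X}$ be a compact subset of a Polish space, let $\mathbb{Y},\mathbb{U}$ be finite sets, let $\beta\in(0,1)$, and let $c:\mathbb{X}\times\mathbb{U}\to\mathbb{R}_+$ be continuous and bounded. Consider a partially observed Markov decision process with hidden state $X_t\in\mathbb{X}$, observations $Y_t\in\mathbb{Y}$ and actions $U_t\in\mathbb{U}$ generated by an exploration policy $\gamma$. Fix a window length $N\in\mathbb{N}$ and, for $t\ge N$, let $$S_t=\{Y_{[t-N,t]},U_{[t-N,t-1]}\}\in\mathbb{S}:=\mathbb{Y}^{N+1}\times\mathbb{U}^N,\qquad C_t=c(X_t,U_t).$$ Assume: (i) Under the exploration policy $\gamma$ and the given initialization, there is a probability measure $\pi^\gamma$ on $\mathbb{X}\times\mathbb{U}$ such that for every measurable, $\pi^\gamma$-integrable $f:\mathbb{X}\times\mathbb{U}\to\mathbb{R}$, almost surely $\lim_{n\to\infty}\frac1n\sum_{t=0}^{n-1}f(X_t,U_t)=\int f\,d\pi^\gamma$. Furthermore, $P(Y_t=y\mid X_t=x)>0$ for every $x\in\mathbb{X}$ and $y\in\mathbb{Y}$. (ii) There is a probability measure $\pi$ on $\mathbb{S}\times\mathbb{S}\times\mathbb{U}\times\mathbb{R}$ such that, for the given initialization and for every measurable, $\pi$-integrable $f$, almost surely $$\lim_{n\to\infty}\frac1n\sum_{t=N}^{N+n-1}f(S_{t+1},S_t,U_t,C_t)=\int f(s_1,s,u,c)\,\pi(ds_1,ds,du,dc),$$ and $\pi(\mathbb{S}\times\{s\}\times\{u\}\times\mathbb{R})>0$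 for every $(s,u)\in\mathbb{S}\times\mathbb{U}$. (iii) The learning rates satisfy: $\alpha_t(s,u)=0$ unless $(S_t,U_t)=(s,u)$; when $(S_t,U_t)=(s,u)$, $\alpha_t(s,u)=\bigl(1+\sum_{k=N}^t1_{\{S_k=s,U_k=u\}}\bigr)^{-1}$; and with probability $1$, $\sum_t\alpha_t(s,u)=\infty$ for all $(s,u)\in\mathbb{S}\times\mathbb{U}$. Then the iterations, for $t\ge N$, $$Q_{t+1}(s,u)=(1-\alpha_t(s,u))Q_t(s,u)+\alpha_t(s,u)\Bigl(C_t+\beta \min_{u'\in\mathbb{U}}Q_t(S_{t+1},u')\Bigr),\qquad (s,u)\in\mathbb{S}\times\mathbb{U},$$ started from any $Q_N:\mathbb{S}\times\mathbb{U}\to\mathbb{R}$, converge almost surely, i.e. for each $(s,u)$, $Q_t(s,u)$ converges almost surely to a finite limit as $t\to\infty$.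
   Context: POMDP model: $P(X_{t+1}\in B\mid X_{[0,t]},Y_{[0,t]},U_{[0,t]})=\mathcal{T}(B|X_t,U_t)$ for a stochastic kernel $\mathcal{T}$ from $\mathbb{X}\times\mathbb{U}$ to $\mathbb{X}$; $Y_t=g(X_t,V_t)$ for a measurable $g$ and an i.i.d. noise $\{V_t\}$, so that $Y_t$ given $X_t=x$ has law $O(\cdot|x)=P(Y_t\in\cdot\mid X_t=x)$. The exploration policy $\gamma$ is a (possibly randomized) non-anticipative rule choosing $U_t$ from $\{Y_{[0,t]},U_{[0,t-1]}\}$. Notation: $Y_{[a,b]}=(Y_a,\dots,Y_b)$ and similarly for $U$, $X$. $1_{\{\cdot\}}$ is an indicator function. *)

theory Defs
  imports "HOL-Probability.Probability"
begin

definition state_space :: "'x::topological_space set \<Rightarrow> 'x measure" where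
  "state_space XX = restrict_space borel XX"

(* seg Z a b is the list (Z_a, ..., Z_{b-1}); note the half-open convention. *)
definition seg :: "(nat \<Rightarrow> 'w \<Rightarrow> 'a) \<Rightarrow> nat \<Rightarrow> nat \<Rightarrow> 'w \<Rightarrow> 'a list" where
  "seg Z a b \<omega> = map (\<lambda>i. Z i \<omega>) [a..<b]"

(* P(A | H) as a random variable, for a random element H of the measurable space K. *)
definition cond_prob_given ::
    "'w measure \<Rightarrow> ('w \<Rightarrow> 'h) \<Rightarrow> 'h measure \<Rightarrow> 'w set \<Rightarrow> 'w \<Rightarrow> real" where
  "cond_prob_given M H K A = real_cond_exp M (vimage_algebra (space M) H K) (indicator A)"

(* The first i states, first j observations and first k actions. *)
definition history ::
    "(nat \<Rightarrow> 'w \<Rightarrow> 'x) \<Rightarrow> (nat \<Rightarrow> 'w \<Rightarrow> 'y) \<Rightarrow> (nat \<Rightarrow> 'w \<Rightarrow> 'u) \<Rightarrow> nat \<Rightarrow> nat \<Rightarrow> nat \<Rightarrow>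
     'w \<Rightarrow> (nat \<Rightarrow> 'x) \<times> 'y list \<times> 'u list" where
  "history X Y U i j k \<omega> = (\<lambda>n\<in>{..<i}. X n \<omega>, seg Y 0 j \<omega>, seg U 0 k \<omega>)"

definition history_space ::
    "'x::topological_space set \<Rightarrow> nat \<Rightarrow> ((nat \<Rightarrow> 'x) \<times> 'y list \<times> 'u list) measure" where
  "history_space XX i =
     (\<Pi>\<^sub>M n\<in>{..<i}. state_space XX) \<Otimes>\<^sub>M count_space UNIV \<Otimes>\<^sub>M count_space UNIV"

(* The observation channel O( . | x): the law of g(x, V) when V has law \<nu>. *)
definition obs_law :: "'v measure \<Rightarrow> ('x \<times> 'v \<Rightarrow> 'y) \<Rightarrow> 'x \<Rightarrow> 'y measure" where
  "obs_law \<nu> g x = distr \<nu> (count_space UNIV) (\<lambda>v. g (x, v))"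

(* A controlled hidden process on (the compact set) XX with transition kernel T, initial law \<mu>,
   observation function g, noise V with common law \<nu>, and exploration policy \<gamma>. The finite
   observation and action sets are the types 'y and 'u. The policy maps the lists Y_{[0,t]} and
   U_{[0,t-1]} to a law on actions; their lengths determine t, so \<gamma> need not be stationary. *)
locale pomdp = prob_space M
  for M :: "'w measure" +
  fixes XX :: "'x::polish_space set"
    and T :: "'x \<times> 'u::finite \<Rightarrow> 'x measure"
    and \<mu> :: "'x measure"
    and \<nu> :: "'v measure"
    and g :: "'x \<times> 'v \<Rightarrow> 'y::finite"
    and \<gamma> :: "'y list \<Rightarrow> 'u list \<Rightarrow> 'u pmf"
    and X :: "nat \<Rightarrow> 'w \<Rightarrow> 'x"
    and V :: "nat \<Rightarrow> 'w \<Rightarrow> 'v"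
    and Y :: "nat \<Rightarrow> 'w \<Rightarrow> 'y"
    and U :: "nat \<Rightarrow> 'w \<Rightarrow> 'u"
  assumes compact_states: "compact XX"
    and X_measurable: "\<And>t. X t \<in> M \<rightarrow>\<^sub>M state_space XX"
    and U_measurable: "\<And>t. U t \<in> M \<rightarrow>\<^sub>M count_space UNIV"
    and kernel: "T \<in> state_space XX \<Otimes>\<^sub>M count_space UNIV \<rightarrow>\<^sub>M prob_algebra (state_space XX)"
    and initial_law: "distr M (state_space XX) (X 0) = \<mu>"
    and transition: "\<And>t B. B \<in> sets (state_space XX) \<Longrightarrow>
      AE \<omega> in M. cond_prob_given M (history X Y U (Suc t) (Suc t) (Suc t))
          (history_space XX (Suc t)) {\<omega> \<in> space M. X (Suc t) \<omega> \<in> B} \<omega>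
        = measure (T (X t \<omega>, U t \<omega>)) B"
    and g_measurable: "g \<in> state_space XX \<Otimes>\<^sub>M \<nu> \<rightarrow>\<^sub>M count_space UNIV"
    and noise_indep: "indep_vars (\<lambda>_. \<nu>) V UNIV"
    and noise_law: "\<And>t. distr M \<nu> (V t) = \<nu>"
    (* V_t is independent of (X_{[0,t]}, Y_{[0,t-1]}, U_{[0,t-1]}); this makes obs_law \<nu> g
       the conditional law of Y_t given X_t. *)
    and noise_past: "\<And>t. indep_set
          (sets (vimage_algebra (space M) (V t) \<nu>))
          (sets (vimage_algebra (space M) (history X Y U (Suc t) t t) (history_space XX (Suc t))))"
    and observation: "\<And>t \<omega>. \<omega> \<in> space M \<Longrightarrow> Y t \<omega> = g (X t \<omega>, V t \<omega>)"
    and policy: "\<And>t u.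
      AE \<omega> in M. cond_prob_given M (history X Y U (Suc t) (Suc t) t)
          (history_space XX (Suc t)) {\<omega> \<in> space M. U t \<omega> = u} \<omega>
        = pmf (\<gamma> (seg Y 0 (Suc t) \<omega>) (seg U 0 t \<omega>)) u"

definition windows :: "nat \<Rightarrow> ('y list \<times> 'u list) set" where
  "windows N = {(ys, us). length ys = Suc N \<and> length us = N}"

(* S_t = (Y_{[t-N,t]}, U_{[t-N,t-1]}); only meaningful for t \<ge> N. *)
definition window ::
    "nat \<Rightarrow> (nat \<Rightarrow> 'w \<Rightarrow> 'y) \<Rightarrow> (nat \<Rightarrow> 'w \<Rightarrow> 'u) \<Rightarrow> nat \<Rightarrow> 'w \<Rightarrow> 'y list \<times> 'u list" where
  "window N Y U t \<omega> = (seg Y (t - N) (Suc t) \<omega>, seg U (t - N) t \<omega>)"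

end

theory Submission
  imports Defs
begin

text \<open>
  The window process need not be Markov, so the usual martingale argument for Q-learning is not
  available. The ergodic averages along a path replace it. Let \<open>\<pi>\<close> be the ergodic measure for
  \<open>(S\<^sub>t\<^sub>+\<^sub>1, S\<^sub>t, U\<^sub>t, C\<^sub>t)\<close> and let \<open>q\<^sup>*\<close> solve the averaged Bellman equation: for every pair
  \<open>(s, u)\<close>, the temporal-difference error \<open>C\<^sub>t + \<beta> min\<^sub>v q\<^sup>*(S\<^sub>t\<^sub>+\<^sub>1, v) - q\<^sup>*(s, u)\<close> has
  \<open>\<pi>\<close>-mean zero on the event \<open>(S\<^sub>t, U\<^sub>t) = (s, u)\<close>. Such a \<open>q\<^sup>*\<close> exists because conditioning
  \<open>\<pi>\<close> on these events, which have positive mass, defines a \<open>\<beta>\<close>-contraction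
  (\<open>averaged_Bellman_equation_solvable\<close>). It is the limit of the iterates.

  Discard the null set on which one of the finitely many relevant time averages fails to converge
  or some rates have a finite sum;
  what remains is a deterministic statement (\<open>Q_learning_path_converges\<close>). Write
  \<open>Q\<^sub>t = q\<^sup>* + W\<^sub>t + E\<^sub>t\<close>, where \<open>W\<close> starts at zero and is driven by the error of \<open>q\<^sup>*\<close> alone:
  \<open>W\<^sub>t\<^sub>+\<^sub>1 = (1 - \<alpha>\<^sub>t) W\<^sub>t + \<alpha>\<^sub>t w\<^sub>t\<close>. The rates are reciprocals of visit counts, so \<open>W\<^sub>t(s, u)\<close> is
  exactly the sum of the past errors at \<open>(s, u)\<close> divided by one plus the number of visits. Dividing
  numerator and denominator by \<open>t\<close> shows that it tends to zero: the numerator averages to zero by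
  the choice of \<open>q\<^sup>*\<close> and the denominator averages to the positive mass of \<open>(s, u)\<close>. The rest
  satisfies
  \<open>E\<^sub>t\<^sub>+\<^sub>1 = (1 - \<alpha>\<^sub>t) E\<^sub>t + \<alpha>\<^sub>t \<beta> (min\<^sub>v Q\<^sub>t(S\<^sub>t\<^sub>+\<^sub>1, v) - min\<^sub>v q\<^sup>*(S\<^sub>t\<^sub>+\<^sub>1, v))\<close>, where
  the factor of \<open>\<alpha>\<^sub>t\<close> has modulus at most \<open>\<beta> (\<parallel>E\<^sub>t\<parallel> + \<parallel>W\<^sub>t\<parallel>)\<close> since the minimum is nonexpansive. As the rates have
  divergent sums, this asynchronous contraction with vanishing perturbation forces \<open>E\<^sub>t\<close> to zero
  (\<open>asynchronous_contraction_tendsto_zero\<close>).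
\<close>

section \<open>Contractions and asynchronous averaging\<close>

text \<open>
  Only the values on \<open>I\<close> are compared, so \<open>F\<close> may act arbitrarily elsewhere; the fixed point is
  found as the pointwise limit on \<open>I\<close> of the Picard iterates.
\<close>

lemma contraction_on_finite_set_has_fixed_point:
  fixes F :: "('i \<Rightarrow> real) \<Rightarrow> 'i \<Rightarrow> real" and \<beta> :: real
  assumes "finite I" and \<beta>: "0 \<le> \<beta>" "\<beta> < 1"
    and contr: "\<And>f h R i. (\<And>j. j \<in> I \<Longrightarrow> \<bar>f j - h j\<bar> \<le> R) \<Longrightarrow> i \<in> I
                  \<Longrightarrow> \<bar>F f i - F h i\<bar> \<le> \<beta> * R"
  obtains f where "\<And>i. i \<in> I \<Longrightarrow> F f i = f i"
proof -
  define it where "it n = (F ^^ n) (\<lambda>_. 0)" for n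
  have it_Suc: "it (Suc n) = F (it n)" for n by (simp add: it_def)
  define R where "R = (\<Sum>i\<in>I. \<bar>it 1 i - it 0 i\<bar>)"
  have step: "\<bar>it (Suc n) i - it n i\<bar> \<le> \<beta> ^ n * R" if "i \<in> I" for n i
    using that
  proof (induction n arbitrary: i)
    case 0
    then show ?case
      unfolding R_def using member_le_sum[of i I "\<lambda>i. \<bar>it 1 i - it 0 i\<bar>"] \<open>finite I\<close> by simp
  next
    case (Suc n)
    have "\<bar>F (it (Suc n)) i - F (it n) i\<bar> \<le> \<beta> * (\<beta> ^ n * R)"
      by (rule contr) (use Suc in auto)
    then show ?case by (simp add: it_Suc mult.assoc)
  qed
  have conv: "convergent (\<lambda>n. it n i)" if "i \<in> I" for i
  proof -
    have "summable (\<lambda>n. it (Suc n) i - it n i)"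
    proof (rule summable_comparison_test)
      show "\<exists>N. \<forall>n\<ge>N. norm (it (Suc n) i - it n i) \<le> \<beta> ^ n * R"
        using step[OF that] by auto
      show "summable (\<lambda>n. \<beta> ^ n * R)"
        using \<beta> by (intro summable_mult2 summable_geometric) auto
    qed
    then have "convergent (\<lambda>n. \<Sum>k<n. it (Suc k) i - it k i)"
      by (simp add: summable_iff_convergent)
    then have "convergent (\<lambda>n. it n i - it 0 i)"
      unfolding sum_lessThan_telescope[of "\<lambda>n. it n i"] .
    then show ?thesis
      using convergent_diff_const_right_iff[of "\<lambda>n. it n i" "it 0 i"] by simp
  qed
  define f where "f i = lim (\<lambda>n. it n i)" for i
  have lim: "(\<lambda>n. it n i) \<longlonglongrightarrow> f i" if "i \<in> I" for i
    using conv[OF that] by (simp add: f_def convergent_LIMSEQ_iff)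
  have "F f i = f i" if "i \<in> I" for i
  proof -
    have "(\<lambda>n. F (it n) i) \<longlonglongrightarrow> F f i"
    proof (rule Lim_null[THEN iffD2], rule Lim_null_comparison)
      show "\<forall>\<^sub>F n in sequentially. norm (F (it n) i - F f i) \<le> \<beta> * (\<Sum>j\<in>I. \<bar>it n j - f j\<bar>)"
      proof (intro always_eventually allI, unfold real_norm_def, rule contr)
        show "\<bar>it n j - f j\<bar> \<le> (\<Sum>j\<in>I. \<bar>it n j - f j\<bar>)" if "j \<in> I" for n j
          using member_le_sum[of j I "\<lambda>j. \<bar>it n j - f j\<bar>"] that \<open>finite I\<close> by simp
      qed (fact that)
      have "(\<lambda>n. \<beta> * (\<Sum>j\<in>I. \<bar>it n j - f j\<bar>)) \<longlonglongrightarrow> \<beta> * (\<Sum>j\<in>I. \<bar>f j - f j\<bar>)"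
        by (intro tendsto_intros lim)
      then show "(\<lambda>n. \<beta> * (\<Sum>j\<in>I. \<bar>it n j - f j\<bar>)) \<longlonglongrightarrow> 0" by simp
    qed
    moreover have "(\<lambda>n. F (it n) i) \<longlonglongrightarrow> f i"
      using LIMSEQ_Suc[OF lim[OF that]] by (simp add: it_Suc)
    ultimately show ?thesis by (rule LIMSEQ_unique)
  qed
  then show thesis using that by blast
qed

text \<open>
  The part of \<open>z\<close> that exceeds the eventual bound \<open>b\<close> on the input is multiplied by at most
  \<open>1 - a t \<le> exp (- a t)\<close> in each step. Since the weights have a divergent sum, the excess dies
  out.
\<close>

lemma weighted_average_eventually_le:
  fixes z a h :: "nat \<Rightarrow> real"
  assumes z: "\<And>t. z (Suc t) = (1 - a t) * z t + a t * h t"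
    and a: "\<And>t. 0 \<le> a t" "\<And>t. a t \<le> 1"
    and div: "filterlim (\<lambda>n. \<Sum>t<n. a t) at_top sequentially"
    and h: "\<forall>\<^sub>F t in sequentially. \<bar>h t\<bar> \<le> b" and "b < b'"
  shows "\<forall>\<^sub>F t in sequentially. \<bar>z t\<bar> \<le> b'"
proof -
  obtain m where m: "\<And>t. m \<le> t \<Longrightarrow> \<bar>h t\<bar> \<le> b"
    using h by (auto simp: eventually_sequentially)
  define K where "K = \<bar>z m\<bar> * exp (\<Sum>k<m. a k)"
  \<comment> \<open>The exponential in \<open>K\<close> cancels the weights spent before time \<open>m\<close>.\<close>
  have bound: "\<bar>z t\<bar> \<le> b + K * exp (- (\<Sum>k<t. a k))" if "m \<le> t" for t
    using that
  proof (induction t rule: dec_induct)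
    case base
    then show ?case using m[of m] by (simp add: K_def exp_minus mult.assoc)
  next
    case (step t)
    let ?e = "K * exp (- (\<Sum>k<t. a k))"
    have "\<bar>z (Suc t)\<bar> \<le> (1 - a t) * \<bar>z t\<bar> + a t * \<bar>h t\<bar>"
      unfolding z using a[of t] by (intro order_trans[OF abs_triangle_ineq]) (simp add: abs_mult)
    also have "\<dots> \<le> (1 - a t) * (b + ?e) + a t * b"
      using a[of t] step m[of t] by (intro add_mono mult_left_mono) auto
    also have "\<dots> = b + (1 - a t) * ?e" by (simp add: algebra_simps)
    also have "\<dots> \<le> b + exp (- a t) * ?e"
      using exp_ge_add_one_self[of "- a t"]
      by (intro add_left_mono mult_right_mono) (auto simp: K_def)
    also have "\<dots> = b + K * exp (- (\<Sum>k<Suc t. a k))"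
      by (simp add: exp_diff exp_minus field_simps)
    finally show ?case .
  qed
  have "(\<lambda>t. b + K * exp (- (\<Sum>k<t. a k))) \<longlonglongrightarrow> b + K * 0"
    by (intro tendsto_intros filterlim_compose[OF exp_at_bot]
        filterlim_compose[OF filterlim_uminus_at_bot_at_top] div)
  then have "\<forall>\<^sub>F t in sequentially. b + K * exp (- (\<Sum>k<t. a k)) < b'"
    using \<open>b < b'\<close> by (intro order_tendstoD) auto
  then show ?thesis
    using eventually_ge_at_top[of m] by eventually_elim (use bound in fastforce)
qed

text \<open>
  An eventual bound \<open>R\<close> on all components makes every input eventually at most
  \<open>\<beta> * R + \<epsilon>\<close>, and averaging passes this smaller bound on to the components. Iterating drives
  the bound down to a multiple of \<open>\<epsilon>\<close>. Uniformity over components comes from the finiteness of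
  \<open>I\<close>; the components may be updated at unrelated times.
\<close>

lemma asynchronous_contraction_tendsto_zero:
  fixes E a h :: "nat \<Rightarrow> 'i \<Rightarrow> real" and \<delta> :: "nat \<Rightarrow> real"
  assumes "finite I" and \<beta>: "0 \<le> \<beta>" "\<beta> < 1"
    and E: "\<And>t i. i \<in> I \<Longrightarrow> E (Suc t) i = (1 - a t i) * E t i + a t i * h t i"
    and a: "\<And>t i. i \<in> I \<Longrightarrow> 0 \<le> a t i" "\<And>t i. i \<in> I \<Longrightarrow> a t i \<le> 1"
    and div: "\<And>i. i \<in> I \<Longrightarrow> filterlim (\<lambda>n. \<Sum>t<n. a t i) at_top sequentially"
    and h: "\<And>t i R. i \<in> I \<Longrightarrow> (\<And>j. j \<in> I \<Longrightarrow> \<bar>E t j\<bar> \<le> R) \<Longrightarrow> \<bar>h t i\<bar> \<le> \<beta> * R + \<delta> t"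
    and \<delta>: "\<delta> \<longlonglongrightarrow> 0"
    and "i \<in> I"
  shows "(\<lambda>t. E t i) \<longlonglongrightarrow> 0"
proof -
  define eb where "eb R \<longleftrightarrow> (\<forall>\<^sub>F t in sequentially. \<forall>j\<in>I. \<bar>E t j\<bar> \<le> R)" for R
  obtain D where D: "0 < D" "\<And>t. \<bar>\<delta> t\<bar> \<le> D"
    using convergent_imp_Bseq[OF convergentI[OF \<delta>]] by (auto simp: Bseq_def)
  \<comment> \<open>The summand \<open>D / (1 - \<beta>)\<close> solves \<open>\<beta> * r + D = r\<close>, which makes the bound \<open>R0\<close> invariant.\<close>
  define R0 where "R0 = (\<Sum>j\<in>I. \<bar>E 0 j\<bar>) + D / (1 - \<beta>)"
  have R0: "\<beta> * R0 + D \<le> R0"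
  proof -
    have "D \<le> (1 - \<beta>) * R0"
      using \<beta> D unfolding R0_def by (simp add: distrib_left sum_nonneg)
    then show ?thesis by (simp add: algebra_simps)
  qed
  have bdd: "\<bar>E t j\<bar> \<le> R0" if "j \<in> I" for t j
    using that
  proof (induction t arbitrary: j)
    case 0
    have "\<bar>E 0 j\<bar> \<le> (\<Sum>j\<in>I. \<bar>E 0 j\<bar>)"
      using member_le_sum[of j I "\<lambda>j. \<bar>E 0 j\<bar>"] 0 \<open>finite I\<close> by simp
    then show ?case using \<beta> D unfolding R0_def by (simp add: add_increasing2)
  next
    case (Suc t)
    have hb: "\<bar>h t j\<bar> \<le> R0"
      using h[OF Suc.prems Suc.IH] R0 D(2)[of t] by fastforce
    have "\<bar>E (Suc t) j\<bar> \<le> (1 - a t j) * \<bar>E t j\<bar> + a t j * \<bar>h t j\<bar>"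
      unfolding E[OF Suc.prems] using a[OF Suc.prems, of t]
      by (intro order_trans[OF abs_triangle_ineq]) (simp add: abs_mult)
    also have "\<dots> \<le> (1 - a t j) * R0 + a t j * R0"
      using a[OF Suc.prems, of t] Suc hb by (intro add_mono mult_left_mono) auto
    finally show ?case by (simp add: algebra_simps)
  qed
  have improve: "eb (\<beta> * R + \<epsilon>)" if "eb R" "0 < \<epsilon>" for R \<epsilon>
  proof -
    have "\<forall>\<^sub>F t in sequentially. \<bar>E t j\<bar> \<le> \<beta> * R + \<epsilon>" if "j \<in> I" for j
    proof (rule weighted_average_eventually_le[where a = "\<lambda>t. a t j" and h = "\<lambda>t. h t j"])
      have "\<forall>\<^sub>F t in sequentially. \<delta> t < \<epsilon> / 2"
        using \<delta> \<open>0 < \<epsilon>\<close> by (intro order_tendstoD) auto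
      with \<open>eb R\<close> show "\<forall>\<^sub>F t in sequentially. \<bar>h t j\<bar> \<le> \<beta> * R + \<epsilon> / 2"
        unfolding eb_def by eventually_elim (use h[OF that] in fastforce)
    qed (use that E a div \<open>0 < \<epsilon>\<close> in auto)
    then show ?thesis
      using \<open>finite I\<close> by (simp add: eb_def eventually_ball_finite_distrib)
  qed
  have geometric: "eb (\<beta> ^ n * R0 + \<epsilon> / (1 - \<beta>))" if "0 < \<epsilon>" for n \<epsilon>
  proof (induction n)
    case 0
    have "R0 \<le> R0 + \<epsilon> / (1 - \<beta>)" using that \<beta> by simp
    then have "\<bar>E t j\<bar> \<le> \<beta> ^ 0 * R0 + \<epsilon> / (1 - \<beta>)" if "j \<in> I" for t j
      using bdd[OF that, of t] by simp
    then show ?case by (simp add: eb_def)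
  next
    case (Suc n)
    have "\<epsilon> / (1 - \<beta>) = \<beta> * (\<epsilon> / (1 - \<beta>)) + \<epsilon>"
      using \<beta> by (simp add: field_simps)
    with improve[OF Suc that] show ?case
      by (simp add: algebra_simps)
  qed
  show ?thesis
  proof (rule tendstoI)
    fix e :: real assume "0 < e"
    have "(\<lambda>n. \<beta> ^ n * R0) \<longlonglongrightarrow> 0 * R0"
      using \<beta> by (intro tendsto_intros LIMSEQ_power_zero) auto
    then have "\<forall>\<^sub>F n in sequentially. \<beta> ^ n * R0 < e / 2"
      using \<open>0 < e\<close> by (intro order_tendstoD) auto
    then obtain n where n: "\<beta> ^ n * R0 < e / 2"
      by (auto simp: eventually_sequentially)
    have "eb (\<beta> ^ n * R0 + (e / 2 * (1 - \<beta>)) / (1 - \<beta>))"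
      using \<open>0 < e\<close> \<beta> by (intro geometric) auto
    moreover have "(e / 2 * (1 - \<beta>)) / (1 - \<beta>) = e / 2"
      using \<beta> by (intro nonzero_mult_div_cancel_right) simp
    ultimately have "eb (\<beta> ^ n * R0 + e / 2)" by (simp only:)
    then show "\<forall>\<^sub>F t in sequentially. dist (E t i) 0 < e"
      unfolding eb_def by eventually_elim (use n \<open>i \<in> I\<close> in fastforce)
  qed
qed

lemma abs_Min_diff_le:
  fixes f h :: "'u::finite \<Rightarrow> real"
  assumes "\<And>u. \<bar>f u - h u\<bar> \<le> R"
  shows "\<bar>(MIN u. f u) - (MIN u. h u)\<bar> \<le> R"
proof -
  have "(MIN u. f u) - R \<le> (MIN u. h u)" if "\<And>u. \<bar>f u - h u\<bar> \<le> R" for f h :: "'u \<Rightarrow> real"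
  proof (rule Min.boundedI)
    fix x assume "x \<in> range h"
    then obtain u where x: "x = h u" by auto
    have "(MIN u. f u) \<le> f u" by (intro Min_le) auto
    then show "(MIN u. f u) - R \<le> x" using that[of u] unfolding x by linarith
  qed auto
  from this[of f h] this[of h f] assms show ?thesis
    by (smt (verit) abs_minus_commute)
qed

section \<open>Noise averaged with harmonic rates\<close>

text \<open>
  Stepping with the reciprocal of one plus the visit count produces a plain average of the inputs
  seen at visits, with an additional zero counted once. Here \<open>r\<close> already counts a visit at time
  \<open>t\<close> itself, which is why its sum runs below \<open>Suc t\<close>.
\<close>

lemma harmonic_rate_update:
  fixes b :: "nat \<Rightarrow> bool" and w :: "nat \<Rightarrow> real"
  defines "W \<equiv> \<lambda>t. (\<Sum>k<t. of_bool (b k) * w k) / (1 + (\<Sum>k<t. of_bool (b k)))"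
  assumes r: "r = of_bool (b t) / (1 + (\<Sum>k<Suc t. of_bool (b k)))"
  shows "W (Suc t) = (1 - r) * W t + r * w t"
proof -
  define n z :: "nat \<Rightarrow> real" where "n t = (\<Sum>k<t. of_bool (b k))"
    and "z t = (\<Sum>k<t. of_bool (b k) * w k)" for t
  have W: "W t = z t / (1 + n t)" for t by (simp only: W_def n_def z_def)
  have r': "r = of_bool (b t) / (1 + n (Suc t))" by (simp only: r n_def)
  have "n (Suc t) = n t + of_bool (b t)" "z (Suc t) = z t + of_bool (b t) * w t"
    unfolding n_def z_def by (rule sum.lessThan_Suc)+
  moreover have "0 \<le> n t" unfolding n_def by (intro sum_nonneg) auto
  then have "1 + n t \<noteq> 0" "1 + (n t + 1) \<noteq> 0" by linarith+
  ultimately show ?thesis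
    unfolding W r' by (cases "b t") (simp_all add: divide_simps)
qed

text \<open>
  This converts an average over time into an average over visits, which is legitimate because
  visits have a positive frequency.
\<close>

lemma harmonic_average_tendsto_zero:
  fixes b :: "nat \<Rightarrow> bool" and w :: "nat \<Rightarrow> real"
  assumes freq: "(\<lambda>n. (1 / real n) * (\<Sum>k<n. of_bool (b k))) \<longlonglongrightarrow> p" and "0 < p"
    and noise: "(\<lambda>n. (1 / real n) * (\<Sum>k<n. of_bool (b k) * w k)) \<longlonglongrightarrow> 0"
  shows "(\<lambda>n. (\<Sum>k<n. of_bool (b k) * w k) / (1 + (\<Sum>k<n. of_bool (b k)))) \<longlonglongrightarrow> 0"
proof -
  have "(\<lambda>n. ((1 / real n) * (\<Sum>k<n. of_bool (b k) * w k))
           / (1 / real n + (1 / real n) * (\<Sum>k<n. of_bool (b k)))) \<longlonglongrightarrow> 0 / (0 + p)"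
    using \<open>0 < p\<close> by (intro tendsto_intros noise freq lim_1_over_n) auto
  moreover have "\<forall>\<^sub>F n in sequentially.
      ((1 / real n) * (\<Sum>k<n. of_bool (b k) * w k))
           / (1 / real n + (1 / real n) * (\<Sum>k<n. of_bool (b k)))
      = (\<Sum>k<n. of_bool (b k) * w k) / (1 + (\<Sum>k<n. of_bool (b k)))"
    using eventually_gt_at_top[of 0]
  proof eventually_elim
    case (elim n)
    then show ?case
      by (simp flip: distrib_left add_divide_distrib)
  qed
  ultimately show ?thesis unfolding div_0 by (rule Lim_transform_eventually)
qed

section \<open>Q-learning along a fixed path\<close>

text \<open>
  All randomness has been moved into the two limits \<open>freq\<close> and \<open>noise\<close>: the first says that each
  pair is visited with positive frequency, the second that \<open>q\<close> is consistent with the path on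
  average. The recursions of \<open>Q\<close> and of the averaged noise are linear with the same rates, so
  subtracting the second leaves the perturbed contraction.
\<close>

lemma Q_learning_path_converges:
  fixes s :: "nat \<Rightarrow> 's" and u :: "nat \<Rightarrow> 'u::finite" and c :: "nat \<Rightarrow> real"
    and a Q :: "nat \<Rightarrow> 's \<Rightarrow> 'u \<Rightarrow> real" and q :: "'s \<Rightarrow> 'u \<Rightarrow> real"
  assumes "finite SS" and s: "\<And>t. s t \<in> SS" and \<beta>: "0 \<le> \<beta>" "\<beta> < 1"
    and rate: "\<And>t x v. x \<in> SS \<Longrightarrow>
        a t x v = of_bool (s t = x \<and> u t = v) / (1 + (\<Sum>k<Suc t. of_bool (s k = x \<and> u k = v)))"
    and div: "\<And>x v. x \<in> SS \<Longrightarrow> filterlim (\<lambda>n. \<Sum>t<n. a t x v) at_top sequentially"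
    and Q: "\<And>t x v. x \<in> SS \<Longrightarrow>
        Q (Suc t) x v = (1 - a t x v) * Q t x v + a t x v * (c t + \<beta> * (MIN v'. Q t (s (Suc t)) v'))"
    and freq: "\<And>x v. x \<in> SS \<Longrightarrow>
        (\<lambda>n. (1 / real n) * (\<Sum>k<n. of_bool (s k = x \<and> u k = v))) \<longlonglongrightarrow> p x v"
    and pos: "\<And>x v. x \<in> SS \<Longrightarrow> 0 < p x v"
    and noise: "\<And>x v. x \<in> SS \<Longrightarrow>
        (\<lambda>n. (1 / real n) * (\<Sum>k<n. of_bool (s k = x \<and> u k = v)
            * (c k + \<beta> * (MIN v'. q (s (Suc k)) v') - q x v))) \<longlonglongrightarrow> 0"
    and x: "x \<in> SS"
  shows "(\<lambda>t. Q t x v) \<longlonglongrightarrow> q x v"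
proof -
  define w where "w x v k = c k + \<beta> * (MIN v'. q (s (Suc k)) v') - q x v" for x v k
  define W where "W t x v = (\<Sum>k<t. of_bool (s k = x \<and> u k = v) * w x v k)
      / (1 + (\<Sum>k<t. of_bool (s k = x \<and> u k = v)))" for t x v
  define I where "I = SS \<times> (UNIV :: 'u set)"
  have "finite I" using \<open>finite SS\<close> by (simp add: I_def)
  define E where "E t i = (case i of (x, v) \<Rightarrow> Q t x v - q x v - W t x v)" for t i
  define h where "h t = \<beta> * ((MIN v'. Q t (s (Suc t)) v') - (MIN v'. q (s (Suc t)) v'))" for t
  define \<delta> where "\<delta> t = \<beta> * (\<Sum>(x, v)\<in>I. \<bar>W t x v\<bar>)" for t
  have W_lim: "(\<lambda>t. W t x v) \<longlonglongrightarrow> 0" if "x \<in> SS" for x v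
    unfolding W_def w_def
    by (rule harmonic_average_tendsto_zero[OF freq[OF that] pos[OF that] noise[OF that]])
  have E_step: "E (Suc t) (x, v) = (1 - a t x v) * E t (x, v) + a t x v * h t" if "x \<in> SS" for t x v
  proof -
    have "W (Suc t) x v = (1 - a t x v) * W t x v + a t x v * w x v t"
      unfolding W_def by (rule harmonic_rate_update) (rule rate[OF that])
    then show ?thesis
      by (simp add: E_def Q[OF that] h_def w_def algebra_simps)
  qed
  have "(\<lambda>t. E t (x, v)) \<longlonglongrightarrow> 0"
  proof (rule asynchronous_contraction_tendsto_zero
      [where I = I and \<beta> = \<beta> and \<delta> = \<delta> and a = "\<lambda>t (x, v). a t x v" and h = "\<lambda>t _. h t"])
    fix t :: nat and i j assume "i \<in> I"
    then obtain x v where i: "i = (x, v)" "x \<in> SS" by (auto simp: I_def)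
    show "E (Suc t) i = (1 - (case i of (x, v) \<Rightarrow> a t x v)) * E t i
            + (case i of (x, v) \<Rightarrow> a t x v) * h t"
      using E_step[OF i(2)] by (simp add: i(1))
    have nn: "(0::real) \<le> (\<Sum>k<t. of_bool (s k = x \<and> u k = v))"
      by (intro sum_nonneg) auto
    show "0 \<le> (case i of (x, v) \<Rightarrow> a t x v)" "(case i of (x, v) \<Rightarrow> a t x v) \<le> 1"
      using nn by (simp_all add: i rate divide_simps)
    show "filterlim (\<lambda>n. \<Sum>t<n. case i of (x, v) \<Rightarrow> a t x v) at_top sequentially"
      using div[OF i(2)] by (simp add: i(1))
  next
    fix t :: nat and i R assume "i \<in> I" and R: "\<And>j. j \<in> I \<Longrightarrow> \<bar>E t j\<bar> \<le> R"
    let ?D = "\<Sum>(x, v)\<in>I. \<bar>W t x v\<bar>"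
    have "\<bar>(MIN v'. Q t (s (Suc t)) v') - (MIN v'. q (s (Suc t)) v')\<bar> \<le> R + ?D"
    proof (rule abs_Min_diff_le)
      fix v'
      have mem: "(s (Suc t), v') \<in> I" using s by (simp add: I_def)
      have "\<bar>W t (s (Suc t)) v'\<bar> \<le> ?D"
        using member_le_sum[OF mem, of "\<lambda>(x, v). \<bar>W t x v\<bar>"] \<open>finite I\<close> by auto
      moreover have "\<bar>Q t (s (Suc t)) v' - q (s (Suc t)) v' - W t (s (Suc t)) v'\<bar> \<le> R"
        using R[OF mem] by (simp add: E_def)
      ultimately show "\<bar>Q t (s (Suc t)) v' - q (s (Suc t)) v'\<bar> \<le> R + ?D" by linarith
    qed
    then show "\<bar>h t\<bar> \<le> \<beta> * R + \<delta> t"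
      using \<beta> unfolding h_def \<delta>_def by (simp add: abs_mult mult_left_mono flip: distrib_left)
  next
    have "\<delta> \<longlonglongrightarrow> \<beta> * (\<Sum>(x, v)\<in>I. \<bar>0\<bar>)"
      unfolding \<delta>_def split_def using W_lim
      by (intro tendsto_intros) (auto simp: I_def)
    then show "\<delta> \<longlonglongrightarrow> 0" by simp
  qed (use \<open>finite I\<close> \<beta> x in \<open>auto simp: I_def\<close>)
  then have "(\<lambda>t. E t (x, v) + q x v + W t x v) \<longlonglongrightarrow> 0 + q x v + 0"
    by (intro tendsto_intros W_lim x)
  then show ?thesis by (simp add: E_def)
qed

section \<open>The averaged Bellman equation\<close>

text \<open>
  Here \<open>\<sigma>\<close> is the next state, \<open>\<kappa>\<close> the cost and \<open>B x v\<close> the event that action \<open>v\<close> is taken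
  in state \<open>x\<close>. The solution is the fixed point of the Bellman operator whose cost and transition
  probabilities are the conditional means given these events. Writing it through integrals over
  \<open>B x v\<close> yields directly the integrand to which an ergodic theorem applies.
\<close>

lemma (in prob_space) averaged_Bellman_equation_solvable:
  fixes \<sigma> :: "'a \<Rightarrow> 's" and B :: "'s \<Rightarrow> 'u::finite \<Rightarrow> 'a set" and \<kappa> :: "'a \<Rightarrow> real"
  assumes "finite SS" and \<beta>: "0 \<le> \<beta>" "\<beta> < 1"
    and \<sigma>[measurable]: "\<sigma> \<in> M \<rightarrow>\<^sub>M count_space SS"
    and B[measurable]: "\<And>x v. x \<in> SS \<Longrightarrow> B x v \<in> events"
    and pos: "\<And>x v. x \<in> SS \<Longrightarrow> 0 < prob (B x v)"
    and \<kappa>[measurable]: "\<kappa> \<in> borel_measurable M" and \<kappa>_bdd: "\<And>z. \<bar>\<kappa> z\<bar> \<le> K"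
  obtains q where
    "\<And>x v. x \<in> SS \<Longrightarrow> integrable M
        (\<lambda>z. indicator (B x v) z * (\<kappa> z + \<beta> * (MIN v'. q (\<sigma> z) v') - q x v))"
    "\<And>x v. x \<in> SS \<Longrightarrow>
        (\<integral>z. indicator (B x v) z * (\<kappa> z + \<beta> * (MIN v'. q (\<sigma> z) v') - q x v) \<partial>M) = 0"
proof -
  define I where "I = SS \<times> (UNIV :: 'u set)"
  have "finite I" using \<open>finite SS\<close> by (simp add: I_def)
  define V where "V f z = (MIN v'. f (\<sigma> z, v'))" for f :: "'s \<times> 'u \<Rightarrow> real" and z
  have V_int: "integrable M (V f)" for f
  proof (rule integrable_const_bound)
    have "(\<lambda>x. MIN v'. f (x, v')) \<in> count_space SS \<rightarrow>\<^sub>M borel" by simp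
    from measurable_compose[OF \<sigma> this] show "V f \<in> borel_measurable M"
      by (simp add: V_def[abs_def])
    have "norm (V f z) \<le> (\<Sum>x\<in>SS. \<bar>MIN v'. f (x, v')\<bar>)" if "z \<in> space M" for z
      using member_le_sum[of "\<sigma> z" SS "\<lambda>x. \<bar>MIN v'. f (x, v')\<bar>"] \<open>finite SS\<close>
        measurable_space[OF \<sigma> that] by (simp add: V_def)
    then show "AE z in M. norm (V f z) \<le> (\<Sum>x\<in>SS. \<bar>MIN v'. f (x, v')\<bar>)" by simp
  qed
  have \<kappa>_int: "integrable M \<kappa>"
    by (rule integrable_const_bound[where B = K]) (use \<kappa>_bdd in auto)
  have int: "integrable M (\<lambda>z. indicator (B x v) z * (\<kappa> z + \<beta> * V f z - r))" if "x \<in> SS" for f x v r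
    using B[OF that, of v] V_int \<kappa>_int
    by (intro integrable_real_mult_indicator[unfolded mult.commute[of _ "indicator _ _"]]) auto
  define F where "F f = (\<lambda>(x, v).
      (\<integral>z. indicator (B x v) z * (\<kappa> z + \<beta> * V f z) \<partial>M) / prob (B x v))" for f
  have contr: "\<bar>F f i - F h i\<bar> \<le> \<beta> * R"
    if R: "\<And>j. j \<in> I \<Longrightarrow> \<bar>f j - h j\<bar> \<le> R" and "i \<in> I" for f h R i
  proof -
    obtain x v where i: "i = (x, v)" and x: "x \<in> SS" using \<open>i \<in> I\<close> by (auto simp: I_def)
    have "F f i - F h i = (\<integral>z. indicator (B x v) z * (\<beta> * V f z - \<beta> * V h z) \<partial>M) / prob (B x v)"
    proof -
      have "(\<integral>z. indicator (B x v) z * (\<beta> * V f z - \<beta> * V h z) \<partial>M)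
          = (\<integral>z. indicator (B x v) z * (\<kappa> z + \<beta> * V f z)
                - indicator (B x v) z * (\<kappa> z + \<beta> * V h z) \<partial>M)"
        by (simp add: algebra_simps)
      also have "\<dots> = (\<integral>z. indicator (B x v) z * (\<kappa> z + \<beta> * V f z) \<partial>M)
          - (\<integral>z. indicator (B x v) z * (\<kappa> z + \<beta> * V h z) \<partial>M)"
        using int[OF x, of v f 0] int[OF x, of v h 0]
        by (intro Bochner_Integration.integral_diff) simp_all
      finally show ?thesis by (simp add: F_def i diff_divide_distrib)
    qed
    moreover have "norm (\<integral>z. indicator (B x v) z * (\<beta> * V f z - \<beta> * V h z) \<partial>M)
        \<le> (\<integral>z. indicator (B x v) z * (\<beta> * R) \<partial>M)"
    proof (intro order_trans[OF Bochner_Integration.integral_norm_bound] integral_mono integrable_norm)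
      show "integrable M (\<lambda>z. indicator (B x v) z * (\<beta> * V f z - \<beta> * V h z))"
        using Bochner_Integration.integrable_diff[OF int[OF x, of v f 0] int[OF x, of v h 0]]
        by (simp add: algebra_simps)
      show "integrable M (\<lambda>z. indicator (B x v) z * (\<beta> * R))"
        using B[OF x, of v] by (intro integrable_mult_left) (simp add: emeasure_eq_measure)
      fix z assume "z \<in> space M"
      then have "\<sigma> z \<in> SS" using measurable_space[OF \<sigma>] by simp
      then have "\<bar>V f z - V h z\<bar> \<le> R"
        unfolding V_def by (intro abs_Min_diff_le R) (simp add: I_def)
      then show "norm (indicator (B x v) z * (\<beta> * V f z - \<beta> * V h z))
          \<le> indicator (B x v) z * (\<beta> * R)"
        using \<beta> by (simp add: abs_mult mult_left_mono flip: right_diff_distrib split: split_indicator)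
    qed
    ultimately show ?thesis
      using pos[OF x, of v] B[OF x, of v] by (simp add: pos_divide_le_eq mult_ac)
  qed
  obtain f where f: "\<And>i. i \<in> I \<Longrightarrow> F f i = f i"
    using contraction_on_finite_set_has_fixed_point[OF \<open>finite I\<close> \<beta>, of F] contr by metis
  define q where "q x v = f (x, v)" for x v
  have V_q: "V f z = (MIN v'. q (\<sigma> z) v')" for z by (simp add: V_def q_def)
  show thesis
  proof (rule that[of q])
    fix x :: 's and v assume x: "x \<in> SS"
    show "integrable M
        (\<lambda>z. indicator (B x v) z * (\<kappa> z + \<beta> * (MIN v'. q (\<sigma> z) v') - q x v))"
      using int[OF x] by (simp flip: V_q)
    have "(\<integral>z. indicator (B x v) z * (\<kappa> z + \<beta> * V f z - q x v) \<partial>M)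
        = (\<integral>z. indicator (B x v) z * (\<kappa> z + \<beta> * V f z) - indicator (B x v) z * q x v \<partial>M)"
      by (simp add: right_diff_distrib)
    also have "\<dots> = (\<integral>z. indicator (B x v) z * (\<kappa> z + \<beta> * V f z) \<partial>M) - prob (B x v) * q x v"
      using int[OF x, of v f 0] B[OF x, of v]
      by (subst Bochner_Integration.integral_diff) (auto simp: emeasure_eq_measure)
    also have "\<dots> = 0"
      using f[of "(x, v)"] pos[OF x, of v] by (simp add: F_def I_def q_def x divide_simps)
    finally show "(\<integral>z. indicator (B x v) z * (\<kappa> z + \<beta> * (MIN v'. q (\<sigma> z) v') - q x v) \<partial>M) = 0"
      by (simp flip: V_q)
  qed
qed

section \<open>Almost sure convergence for finite windows\<close>

lemma finite_windows: "finite (windows N :: ('y::finite list \<times> 'u::finite list) set)"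
proof -
  have "windows N = {ys :: 'y list. set ys \<subseteq> UNIV \<and> length ys = Suc N}
      \<times> {us :: 'u list. set us \<subseteq> UNIV \<and> length us = N}"
    by (auto simp: windows_def)
  then show ?thesis by (simp only: finite_cartesian_product finite_lists_length_eq finite_code)
qed

lemma window_in_windows: "N \<le> t \<Longrightarrow> window N Y U t \<omega> \<in> windows N"
  by (simp add: window_def windows_def seg_def)

theorem corollary3p3:
  fixes M :: "'w measure"
    and XX :: "'x::polish_space set"
    and T :: "'x \<times> 'u::finite \<Rightarrow> 'x measure"
    and \<mu> :: "'x measure"
    and \<nu> :: "'v measure"
    and g :: "'x \<times> 'v \<Rightarrow> 'y::finite"
    and \<gamma> :: "'y list \<Rightarrow> 'u list \<Rightarrow> 'u pmf"
    and X :: "nat \<Rightarrow> 'w \<Rightarrow> 'x"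
    and V :: "nat \<Rightarrow> 'w \<Rightarrow> 'v"
    and Y :: "nat \<Rightarrow> 'w \<Rightarrow> 'y"
    and U :: "nat \<Rightarrow> 'w \<Rightarrow> 'u"
    and c :: "'x \<times> 'u \<Rightarrow> real"
    and \<beta> :: real
    and N :: nat
    and S :: "nat \<Rightarrow> 'w \<Rightarrow> 'y list \<times> 'u list"
    and C :: "nat \<Rightarrow> 'w \<Rightarrow> real"
    and \<alpha> :: "nat \<Rightarrow> 'w \<Rightarrow> 'y list \<times> 'u list \<Rightarrow> 'u \<Rightarrow> real"
    and Q :: "nat \<Rightarrow> 'w \<Rightarrow> 'y list \<times> 'u list \<Rightarrow> 'u \<Rightarrow> real"
    and q :: "'y list \<times> 'u list \<Rightarrow> 'u \<Rightarrow> real"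
  assumes S_eq: "S = window N Y U"
    and C_eq: "C = (\<lambda>t \<omega>. c (X t \<omega>, U t \<omega>))"
    and model: "pomdp M XX T \<mu> \<nu> g \<gamma> X V Y U"
    and discount: "0 < \<beta>" "\<beta> < 1"
    and cost_continuous:
      "continuous_map (prod_topology (top_of_set XX) (discrete_topology UNIV)) euclideanreal c"
    and cost_bounded: "bounded (c ` (XX \<times> UNIV))"
    and cost_nonneg: "\<And>x u. x \<in> XX \<Longrightarrow> 0 \<le> c (x, u)"
    and ergodic_state:
      "\<exists>\<pi>\<gamma>. prob_space \<pi>\<gamma> \<and> sets \<pi>\<gamma> = sets (state_space XX \<Otimes>\<^sub>M count_space (UNIV :: 'u set)) \<and>
         (\<forall>f :: 'x \<times> 'u \<Rightarrow> real. integrable \<pi>\<gamma> f \<longrightarrow>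
           (AE \<omega> in M. (\<lambda>n. (1 / real n) * (\<Sum>t<n. f (X t \<omega>, U t \<omega>)))
              \<longlonglongrightarrow> (\<integral>z. f z \<partial>\<pi>\<gamma>)))"
    and obs_positive: "\<And>x y. x \<in> XX \<Longrightarrow> 0 < measure (obs_law \<nu> g x) {y}"
    and ergodic_window:
      "\<exists>\<pi>. prob_space \<pi> \<and>
         sets \<pi> = sets (count_space (windows N) \<Otimes>\<^sub>M count_space (windows N) \<Otimes>\<^sub>M
                        count_space UNIV \<Otimes>\<^sub>M borel) \<and>
         (\<forall>f :: ('y list \<times> 'u list) \<times> ('y list \<times> 'u list) \<times> 'u \<times> real \<Rightarrow> real.
           integrable \<pi> f \<longrightarrow>
           (AE \<omega> in M. (\<lambda>n. (1 / real n) *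
                (\<Sum>t=N..<N + n. f (S (Suc t) \<omega>, S t \<omega>, U t \<omega>, C t \<omega>)))
              \<longlonglongrightarrow> (\<integral>z. f z \<partial>\<pi>))) \<and>
         (\<forall>s\<in>windows N. \<forall>u. 0 < measure \<pi> (windows N \<times> {s} \<times> {u} \<times> UNIV))"
    and rate_zero:
      "\<And>t \<omega> s u. \<lbrakk>N \<le> t; \<omega> \<in> space M; s \<in> windows N; (S t \<omega>, U t \<omega>) \<noteq> (s, u)\<rbrakk>
         \<Longrightarrow> \<alpha> t \<omega> s u = 0"
    and rate_visit:
      "\<And>t \<omega> s u. \<lbrakk>N \<le> t; \<omega> \<in> space M; s \<in> windows N; (S t \<omega>, U t \<omega>) = (s, u)\<rbrakk>
         \<Longrightarrow> \<alpha> t \<omega> s u = 1 / (1 + (\<Sum>k=N..t. of_bool (S k \<omega> = s \<and> U k \<omega> = u)))"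
    and rate_sum:
      "AE \<omega> in M. \<forall>s\<in>windows N. \<forall>u.
         filterlim (\<lambda>n. \<Sum>t=N..<n. \<alpha> t \<omega> s u) at_top sequentially"
    and Q_init: "\<And>\<omega> s u. \<lbrakk>\<omega> \<in> space M; s \<in> windows N\<rbrakk> \<Longrightarrow> Q N \<omega> s u = q s u"
    and Q_step:
      "\<And>t \<omega> s u. \<lbrakk>N \<le> t; \<omega> \<in> space M; s \<in> windows N\<rbrakk> \<Longrightarrow>
         Q (Suc t) \<omega> s u =
           (1 - \<alpha> t \<omega> s u) * Q t \<omega> s u + \<alpha> t \<omega> s u * (C t \<omega> + \<beta> * (MIN u'. Q t \<omega> (S (Suc t) \<omega>) u'))"
  shows "\<forall>s\<in>windows N. \<forall>u. AE \<omega> in M. convergent (\<lambda>t. Q t \<omega> s u)"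
proof -
  interpret pomdp M XX T \<mu> \<nu> g \<gamma> X V Y U by (rule model)
  obtain \<pi> where \<pi>: "prob_space \<pi>"
    and sets_\<pi>[measurable_cong]: "sets \<pi> = sets (count_space (windows N) \<Otimes>\<^sub>M count_space (windows N) \<Otimes>\<^sub>M
                        count_space UNIV \<Otimes>\<^sub>M borel)"
    and erg: "\<And>f :: ('y list \<times> 'u list) \<times> ('y list \<times> 'u list) \<times> 'u \<times> real \<Rightarrow> real.
           integrable \<pi> f \<Longrightarrow>
           (AE \<omega> in M. (\<lambda>n. (1 / real n) *
                (\<Sum>t=N..<N + n. f (S (Suc t) \<omega>, S t \<omega>, U t \<omega>, C t \<omega>)))
              \<longlonglongrightarrow> (\<integral>z. f z \<partial>\<pi>))"
    and pos: "\<And>s u. s \<in> windows N \<Longrightarrow> 0 < measure \<pi> (windows N \<times> {s} \<times> {u} \<times> UNIV)"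
    using ergodic_window by blast
  interpret \<pi>: prob_space \<pi> by (rule \<pi>)
  have space_\<pi>: "space \<pi> = windows N \<times> windows N \<times> UNIV \<times> UNIV"
    using sets_eq_imp_space_eq[OF sets_\<pi>] by (simp add: space_pair_measure)
  obtain K where K: "\<And>x u. x \<in> XX \<Longrightarrow> \<bar>c (x, u)\<bar> \<le> K"
    using cost_bounded by (force simp: bounded_iff)
  \<comment> \<open>Under \<open>\<pi>\<close> the cost coordinate is a priori unbounded. Clamping it makes every test function
      integrable and changes nothing along a path, where costs lie within the bound.\<close>
  define \<kappa> where "\<kappa> z = max (- \<bar>K\<bar>) (min \<bar>K\<bar> (snd (snd (snd z))))"
    for z :: "('y list \<times> 'u list) \<times> ('y list \<times> 'u list) \<times> 'u \<times> real"
  define B where "B s u = (windows N :: ('y list \<times> 'u list) set) \<times> {s} \<times> {u} \<times> (UNIV :: real set)"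
    for s :: "'y list \<times> 'u list" and u :: 'u
  have B: "B s u \<in> sets \<pi>" if "s \<in> windows N" for s u
    unfolding B_def sets_\<pi> using that by (intro pair_measureI) auto
  obtain q' where
    int: "\<And>s u. s \<in> windows N \<Longrightarrow> integrable \<pi>
        (\<lambda>z. indicator (B s u) z * (\<kappa> z + \<beta> * (MIN u'. q' (fst z) u') - q' s u))" and
    zero: "\<And>s u. s \<in> windows N \<Longrightarrow>
        (\<integral>z. indicator (B s u) z * (\<kappa> z + \<beta> * (MIN u'. q' (fst z) u') - q' s u) \<partial>\<pi>) = 0"
  proof (rule \<pi>.averaged_Bellman_equation_solvable[of "windows N" \<beta> fst B \<kappa> "\<bar>K\<bar>"])
    show "fst \<in> \<pi> \<rightarrow>\<^sub>M count_space (windows N)" by measurable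
    show "\<kappa> \<in> borel_measurable \<pi>" unfolding \<kappa>_def by measurable
  qed (use discount B pos finite_windows in \<open>auto simp: \<kappa>_def B_def\<close>)
  have freq: "AE \<omega> in M. \<forall>s\<in>windows N. \<forall>u\<in>UNIV. (\<lambda>n. (1 / real n) *
      (\<Sum>t=N..<N + n. indicator (B s u) (S (Suc t) \<omega>, S t \<omega>, U t \<omega>, C t \<omega>)))
        \<longlonglongrightarrow> measure \<pi> (B s u)"
  proof (intro AE_finite_allI finite_windows finite)
    fix s :: "'y list \<times> 'u list" and u :: 'u assume s: "s \<in> windows N"
    have "integrable \<pi> (indicator (B s u) :: _ \<Rightarrow> real)"
      using B[OF s] by (simp add: \<pi>.emeasure_eq_measure)
    from erg[OF this] show "AE \<omega> in M. (\<lambda>n. (1 / real n) *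
      (\<Sum>t=N..<N + n. indicator (B s u) (S (Suc t) \<omega>, S t \<omega>, U t \<omega>, C t \<omega>)))
        \<longlonglongrightarrow> measure \<pi> (B s u)" using B[OF s] by simp
  qed
  have noise: "AE \<omega> in M. \<forall>s\<in>windows N. \<forall>u\<in>UNIV. (\<lambda>n. (1 / real n) *
      (\<Sum>t=N..<N + n. indicator (B s u) (S (Suc t) \<omega>, S t \<omega>, U t \<omega>, C t \<omega>) *
          (\<kappa> (S (Suc t) \<omega>, S t \<omega>, U t \<omega>, C t \<omega>) + \<beta> * (MIN u'. q' (S (Suc t) \<omega>) u') - q' s u)))
        \<longlonglongrightarrow> 0"
  proof (intro AE_finite_allI finite_windows finite)
    fix s :: "'y list \<times> 'u list" and u :: 'u assume s: "s \<in> windows N"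
    show "AE \<omega> in M. (\<lambda>n. (1 / real n) *
      (\<Sum>t=N..<N + n. indicator (B s u) (S (Suc t) \<omega>, S t \<omega>, U t \<omega>, C t \<omega>) *
          (\<kappa> (S (Suc t) \<omega>, S t \<omega>, U t \<omega>, C t \<omega>) + \<beta> * (MIN u'. q' (S (Suc t) \<omega>) u') - q' s u)))
        \<longlonglongrightarrow> 0"
      using erg[OF int[OF s]] by (simp only: zero[OF s] fst_conv)
  qed
  \<comment> \<open>The iteration starts at time \<open>N\<close>, whereas the path lemma counts time from zero.\<close>
  have shift: "(\<Sum>t=N..<N + n. f t) = (\<Sum>k<n. f (N + k))" for f :: "nat \<Rightarrow> real" and n
    using sum.shift_bounds_nat_ivl[of f 0 N n] by (simp add: atLeast0LessThan add.commute)
  have "AE \<omega> in M. \<forall>s\<in>windows N. \<forall>u. (\<lambda>t. Q (N + t) \<omega> s u) \<longlonglongrightarrow> q' s u"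
    using AE_space freq noise rate_sum
  proof eventually_elim
    case (elim \<omega>)
    have S: "S t \<omega> \<in> windows N" if "N \<le> t" for t
      unfolding S_eq by (rule window_in_windows[OF that])
    have C: "\<kappa> (x, y, z, C t \<omega>) = C t \<omega>" for x y z t
    proof -
      have "X t \<omega> \<in> XX"
        using measurable_space[OF X_measurable elim(1), of t]
        by (simp add: state_space_def space_restrict_space)
      from K[OF this, of "U t \<omega>"] show ?thesis by (auto simp: \<kappa>_def C_eq)
    qed
    have ind: "indicator (B s u) (S (Suc t) \<omega>, S t \<omega>, U t \<omega>, C t \<omega>)
        = (of_bool (S t \<omega> = s \<and> U t \<omega> = u) :: real)" if "N \<le> t" for s u t
      using S[of "Suc t"] that by (auto simp: B_def indicator_def)
    have "(\<lambda>t. Q (N + t) \<omega> s u) \<longlonglongrightarrow> q' s u" if s: "s \<in> windows N" for s u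
    proof (rule Q_learning_path_converges[where SS = "windows N" and \<beta> = \<beta>
          and s = "\<lambda>t. S (N + t) \<omega>" and u = "\<lambda>t. U (N + t) \<omega>" and c = "\<lambda>t. C (N + t) \<omega>"
          and a = "\<lambda>t. \<alpha> (N + t) \<omega>" and p = "\<lambda>s u. measure \<pi> (B s u)"])
      fix t and s :: "'y list \<times> 'u list" and u assume s: "s \<in> windows N"
      have "(\<Sum>k=N..N + t. of_bool (S k \<omega> = s \<and> U k \<omega> = u))
          = (\<Sum>k<Suc t. of_bool (S (N + k) \<omega> = s \<and> U (N + k) \<omega> = u) :: real)"
        using shift[of "\<lambda>k. of_bool (S k \<omega> = s \<and> U k \<omega> = u)" "Suc t"]
        by (simp only: add_Suc_right atLeastLessThanSuc_atLeastAtMost)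
      then show "\<alpha> (N + t) \<omega> s u = of_bool (S (N + t) \<omega> = s \<and> U (N + t) \<omega> = u)
          / (1 + (\<Sum>k<Suc t. of_bool (S (N + k) \<omega> = s \<and> U (N + k) \<omega> = u)))"
        using rate_zero[OF le_add1 elim(1) s, of t u] rate_visit[OF le_add1 elim(1) s, of t u]
        by (cases "(S (N + t) \<omega>, U (N + t) \<omega>) = (s, u)") (simp_all only: prod.inject, auto)
      show "Q (N + Suc t) \<omega> s u = (1 - \<alpha> (N + t) \<omega> s u) * Q (N + t) \<omega> s u
          + \<alpha> (N + t) \<omega> s u * (C (N + t) \<omega> + \<beta> * (MIN v'. Q (N + t) \<omega> (S (N + Suc t) \<omega>) v'))"
        using Q_step[OF le_add1 elim(1) s, of t u] by simp
    next
      fix s :: "'y list \<times> 'u list" and u assume s: "s \<in> windows N"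
      have "filterlim (\<lambda>n. \<Sum>t=N..<N + n. \<alpha> t \<omega> s u) at_top sequentially"
        using elim(4) s
        by (intro filterlim_compose[OF _ filterlim_add_const_nat_at_top[of N],
              unfolded add.commute[of _ N]]) auto
      then show "filterlim (\<lambda>n. \<Sum>t<n. \<alpha> (N + t) \<omega> s u) at_top sequentially"
        by (simp only: shift)
      show "(\<lambda>n. (1 / real n) * (\<Sum>k<n. of_bool (S (N + k) \<omega> = s \<and> U (N + k) \<omega> = u)))
          \<longlonglongrightarrow> measure \<pi> (B s u)"
        using bspec[OF bspec[OF elim(2) s] UNIV_I, of u] by (simp only: shift ind[OF le_add1])
      show "0 < measure \<pi> (B s u)" using pos[OF s] by (simp add: B_def)
      show "(\<lambda>n. (1 / real n) * (\<Sum>k<n. of_bool (S (N + k) \<omega> = s \<and> U (N + k) \<omega> = u)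
            * (C (N + k) \<omega> + \<beta> * (MIN v'. q' (S (N + Suc k) \<omega>) v') - q' s u))) \<longlonglongrightarrow> 0"
        using bspec[OF bspec[OF elim(3) s] UNIV_I, of u]
        by (simp only: shift ind[OF le_add1] C add_Suc_right)
    qed (use discount s S finite_windows in auto)
    then show ?case by blast
  qed
  then have "AE \<omega> in M. \<forall>s\<in>windows N. \<forall>u. convergent (\<lambda>t. Q t \<omega> s u)"
  proof eventually_elim
    case (elim \<omega>)
    show ?case
    proof (intro ballI allI)
      fix s :: "'y list \<times> 'u list" and u :: 'u assume "s \<in> windows N"
      with elim have "(\<lambda>t. Q (t + N) \<omega> s u) \<longlonglongrightarrow> q' s u" by (simp add: add.commute)
      then show "convergent (\<lambda>t. Q t \<omega> s u)"
        by (auto dest: LIMSEQ_offset intro: convergentI)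
    qed
  qed
  then show ?thesis by (auto elim: eventually_mono)
qed

end
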